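(* Let $S(t)$ be an asymptotically compact semiflow on a complete metric space $X$, let $\mathscr{A}$ be an attractor of $S(t)$ with attraction basin $\Omega=\Omega(\mathscr{A})$ and Morse decomposition $\mathcal{M}=\{M_1,\dots,M_l\}$, and let $V$ be a strict Morse-Lyapunov function of $\mathcal{M}$ on $\Omega$. Let $-\infty<a<b<+\infty$. If $V$ has no generalized critical values in $[a,b]$, then $V_a$ is a strong deformation retract of $V_b$.
   Context: $(X,d)$ is a complete metric space. $C(U)$ denotes the continuous real-valued functions on $U$. A semiflow on $X$ is a continuous map $S:[0,\infty)\times X\to X$, written $S(t)x=S(t,x)$, with $S(0)x=x$ and $S(t+s)x=S(t)S(s)x$ for all $t,s\ge 0$, $x\in X$. It is asymptotically compact if, whenever $(x_n)$ is a bounded sequence in $X$, $t_n\to+\infty$ and $(S(t_n)x_n)$ is bounded, the sequence $(S(t_n)x_n)$ has a convergent subsequence. For $A\subset X$ and $\varepsilon>0$, $B(A,\varepsilon)=\{y\in X: d(y,A)<\varepsilon\}$. A set $U$ is a neighborhood of $A$ if $\overline{A}\subset\operatorname{int}U$. $A$ attracts $B\subset X$ if for every $\varepsilon>0$ there is $T>0$ with $S(t)B\subset B(A,\varepsilon)$ for all $t>T$. $A$ is invariant if $S(t)A=A$ for all $t\ge0$. An attractor is a compact invariant set that attracts some neighborhood of itself. The attraction basin of $A$ is $\Omega(A)=\{x: \lim_{t\to\infty}d(S(t)x,A)=0\}$ (an open set when $A$ is an attractor). Morse decompositions: let $\mathscr{A}$ be an attractor. A compact set $A\subset\mathscr{A}$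 is an attractor of $S(t)$ in $\mathscr{A}$ if it is an attractor of the restriction of $S(t)$ to $\mathscr{A}$ (the empty set is allowed). Its dual repeller is $A^*=\{x\in\mathscr{A}:\omega(x)\cap A=\emptyset\}$, where $\omega(x)=\{y:\exists\,t_n\to+\infty,\ S(t_n)x\to y\}$. An ordered collection $\mathcal{M}=\{M_1,\dots,M_l\}$ of subsets of $\mathscr{A}$ is a Morse decomposition of $\mathscr{A}$, with Morse sets $M_k$, if there is a strictly increasing sequence $\emptyset=A_0\subsetneq A_1\subsetneq\cdots\subsetneq A_l=\mathscr{A}$ of attractors of $S(t)$ in $\mathscr{A}$ such that $M_k=A_k\cap A_{k-1}^*$ for $1\le k\le l$. Put $\mathcal{R}=\bigcup_{1\le k\le l}M_k$. A function $V\in C(\Omega)$ is a Morse-Lyapunov function of $\mathcal{M}$ on $\Omega$ if (1) $V$ is constant on each $M_k$ and (2) $t\mapsto V(S(t)x)$ is strictly decreasing in $t$ for each $x\in\Omega\setminus\mathcal{R}$. It is strict if in addition $V(M_1)<V(M_2)<\cdots<V(M_l)$, where $V(M_k)$ is the constant value of $V$ on $M_k$. The numbers $c_k=V(M_k)$, $1\le k\le l$, are the generalized critical values of $V$. For $a\in\mathbb{R}$, $V_a=\{x\in\Omega: V(x)\le a\}$. A subset $F$ of a topological space $E$ is a strong deformation retract of $E$ if there is a continuous map $H:[0,1]\times E\to E$ with $H(0,\cdot)=\mathrm{id}_E$, $H(1,E)\subset F$, and $H(\sigma,\cdot)|_F=\mathrm{id}_F$ for all $\sigma\in[0,1]$.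 *)

theory Defs
  imports "HOL-Analysis.Analysis"
begin

text \<open>A semiflow is represented by a function on all of \<open>real\<close>; its values at negative times
  are never used.\<close>

definition semiflow :: "(real \<Rightarrow> 'a::metric_space \<Rightarrow> 'a) \<Rightarrow> bool" where
  "semiflow S \<longleftrightarrow>
     continuous_on ({0..} \<times> UNIV) (\<lambda>(t, x). S t x) \<and>
     (\<forall>x. S 0 x = x) \<and>
     (\<forall>t\<ge>0. \<forall>s\<ge>0. \<forall>x. S (t + s) x = S t (S s x))"

definition asymptotically_compact :: "(real \<Rightarrow> 'a::metric_space \<Rightarrow> 'a) \<Rightarrow> bool" where
  "asymptotically_compact S \<longleftrightarrow>
     (\<forall>(x :: nat \<Rightarrow> 'a) (t :: nat \<Rightarrow> real).
        bounded (range x) \<longrightarrow> (\<forall>n. 0 \<le> t n) \<longrightarrow> filterlim t at_top sequentially \<longrightarrow>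
        bounded (range (\<lambda>n. S (t n) (x n))) \<longrightarrow>
        (\<exists>r :: nat \<Rightarrow> nat. strict_mono r \<and> convergent (\<lambda>n. S (t (r n)) (x (r n)))))"

text \<open>The set of all \<open>y\<close> with \<open>d(y, A) < \<epsilon>\<close>. It is not written with \<open>infdist\<close>, because
  \<open>infdist y {} = 0\<close>, whereas the neighbourhood of the empty set should be empty.\<close>

definition ball_around :: "'a::metric_space set \<Rightarrow> real \<Rightarrow> 'a set" where
  "ball_around A \<epsilon> = {y. \<exists>a\<in>A. dist y a < \<epsilon>}"

text \<open>Closure and interior are taken in the subspace \<open>E\<close>, so that the same notions serve for the
  whole space (\<open>E = UNIV\<close>) and for the restriction of a semiflow to an invariant set \<open>E\<close>.\<close>

definition neighborhood_in :: "'a::topological_space set \<Rightarrow> 'a set \<Rightarrow> 'a set \<Rightarrow> bool" where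
  "neighborhood_in E U A \<longleftrightarrow>
     U \<subseteq> E \<and> top_of_set E closure_of A \<subseteq> top_of_set E interior_of U"

definition attracts :: "(real \<Rightarrow> 'a::metric_space \<Rightarrow> 'a) \<Rightarrow> 'a set \<Rightarrow> 'a set \<Rightarrow> bool" where
  "attracts S A B \<longleftrightarrow> (\<forall>\<epsilon>>0. \<exists>T>0. \<forall>t>T. S t ` B \<subseteq> ball_around A \<epsilon>)"

definition invariant :: "(real \<Rightarrow> 'a \<Rightarrow> 'a) \<Rightarrow> 'a set \<Rightarrow> bool" where
  "invariant S A \<longleftrightarrow> (\<forall>t\<ge>0. S t ` A = A)"

definition attractor_in :: "(real \<Rightarrow> 'a::metric_space \<Rightarrow> 'a) \<Rightarrow> 'a set \<Rightarrow> 'a set \<Rightarrow> bool" where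
  "attractor_in S E A \<longleftrightarrow>
     A \<subseteq> E \<and> compact A \<and> invariant S A \<and> (\<exists>U. neighborhood_in E U A \<and> attracts S A U)"

abbreviation attractor :: "(real \<Rightarrow> 'a::metric_space \<Rightarrow> 'a) \<Rightarrow> 'a set \<Rightarrow> bool" where
  "attractor S A \<equiv> attractor_in S UNIV A"

text \<open>Since \<open>infdist y {} = 0\<close>, the condition \<open>A \<noteq> {}\<close> is needed to make the basin of the empty
  attractor empty.\<close>

definition basin :: "(real \<Rightarrow> 'a::metric_space \<Rightarrow> 'a) \<Rightarrow> 'a set \<Rightarrow> 'a set" where
  "basin S A = {x. A \<noteq> {} \<and> ((\<lambda>t. infdist (S t x) A) \<longlongrightarrow> 0) at_top}"

definition omega_limit :: "(real \<Rightarrow> 'a::metric_space \<Rightarrow> 'a) \<Rightarrow> 'a \<Rightarrow> 'a set" where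
  "omega_limit S x =
     {y. \<exists>t :: nat \<Rightarrow> real. (\<forall>n. 0 \<le> t n) \<and> filterlim t at_top sequentially \<and>
           (\<lambda>n. S (t n) x) \<longlonglongrightarrow> y}"

definition dual_repeller ::
    "(real \<Rightarrow> 'a::metric_space \<Rightarrow> 'a) \<Rightarrow> 'a set \<Rightarrow> 'a set \<Rightarrow> 'a set" where
  "dual_repeller S \<A> A = {x \<in> \<A>. omega_limit S x \<inter> A = {}}"

text \<open>The Morse sets are \<open>M 1, \<dots>, M l\<close>; the values of \<open>M\<close> at other indices are irrelevant.\<close>

definition morse_decomposition ::
    "(real \<Rightarrow> 'a::metric_space \<Rightarrow> 'a) \<Rightarrow> 'a set \<Rightarrow> nat \<Rightarrow> (nat \<Rightarrow> 'a set) \<Rightarrow> bool" where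
  "morse_decomposition S \<A> l M \<longleftrightarrow>
     (\<exists>A :: nat \<Rightarrow> 'a set.
        A 0 = {} \<and> A l = \<A> \<and>
        (\<forall>k\<in>{1..l}. A (k - 1) \<subset> A k) \<and>
        (\<forall>k\<in>{0..l}. attractor_in S \<A> (A k)) \<and>
        (\<forall>k\<in>{1..l}. M k = A k \<inter> dual_repeller S \<A> (A (k - 1))))"

definition morse_lyapunov ::
    "(real \<Rightarrow> 'a::metric_space \<Rightarrow> 'a) \<Rightarrow> nat \<Rightarrow> (nat \<Rightarrow> 'a set) \<Rightarrow> 'a set \<Rightarrow> ('a \<Rightarrow> real) \<Rightarrow> bool"
  where
  "morse_lyapunov S l M \<Omega> V \<longleftrightarrow>
     continuous_on \<Omega> V \<and>
     (\<forall>k\<in>{1..l}. V constant_on M k) \<and>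
     (\<forall>x \<in> \<Omega> - (\<Union>k\<in>{1..l}. M k). strict_antimono_on {0..} (\<lambda>t. V (S t x)))"

text \<open>The constant value \<open>V(N)\<close> of \<open>V\<close> on a nonempty set \<open>N\<close>. Morse sets are nonempty because the
  defining sequence of attractors is strictly increasing.\<close>

definition constant_value :: "('a \<Rightarrow> real) \<Rightarrow> 'a set \<Rightarrow> real" where
  "constant_value V N = (THE c. V ` N = {c})"

definition strict_morse_lyapunov ::
    "(real \<Rightarrow> 'a::metric_space \<Rightarrow> 'a) \<Rightarrow> nat \<Rightarrow> (nat \<Rightarrow> 'a set) \<Rightarrow> 'a set \<Rightarrow> ('a \<Rightarrow> real) \<Rightarrow> bool"
  where
  "strict_morse_lyapunov S l M \<Omega> V \<longleftrightarrow>
     morse_lyapunov S l M \<Omega> V \<and> strict_mono_on {1..l} (\<lambda>k. constant_value V (M k))"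

definition generalized_critical_values ::
    "nat \<Rightarrow> (nat \<Rightarrow> 'a set) \<Rightarrow> ('a \<Rightarrow> real) \<Rightarrow> real set" where
  "generalized_critical_values l M V = (\<lambda>k. constant_value V (M k)) ` {1..l}"

definition sublevel :: "'a set \<Rightarrow> ('a \<Rightarrow> real) \<Rightarrow> real \<Rightarrow> 'a set" where
  "sublevel \<Omega> V a = {x \<in> \<Omega>. V x \<le> a}"

definition strong_deformation_retract ::
    "'a::topological_space set \<Rightarrow> 'a set \<Rightarrow> bool" where
  "strong_deformation_retract F E \<longleftrightarrow>
     F \<subseteq> E \<and>
     (\<exists>H :: real \<times> 'a \<Rightarrow> 'a.
        continuous_on ({0..1} \<times> E) H \<and> H ` ({0..1} \<times> E) \<subseteq> E \<and>
        (\<forall>x\<in>E. H (0, x) = x) \<and>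
        (\<forall>x\<in>E. H (1, x) \<in> F) \<and>
        (\<forall>\<sigma>\<in>{0..1}. \<forall>x\<in>F. H (\<sigma>, x) = x))"

end

theory Submission
  imports Defs
begin

text \<open>Points of the slab \<open>a \<le> V \<le> b\<close> lie off the Morse sets, so \<open>V\<close> decreases strictly along their
  orbits. Such an orbit must leave the slab: otherwise \<open>V\<close> would be constant, with value in
  \<open>[a, b]\<close>, along the orbit of any of its limit points in the attractor. It therefore crosses the
  level \<open>a\<close> exactly once, at a time \<open>\<tau> x\<close> that depends continuously on \<open>x\<close> by strict
  monotonicity, and \<open>(\<sigma>, x) \<mapsto> S (\<sigma> * \<tau> x) x\<close> is the deformation.\<close>

section \<open>Semiflows, basins and limit points\<close>

lemma semiflow_continuous_on:
  assumes "semiflow S" "continuous_on E f" "continuous_on E g" "\<And>x. x \<in> E \<Longrightarrow> 0 \<le> f x"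
  shows "continuous_on E (\<lambda>x. S (f x) (g x))"
proof -
  have "continuous_on E ((\<lambda>(t, x). S t x) \<circ> (\<lambda>x. (f x, g x)))"
    using assms unfolding semiflow_def
    by (intro continuous_on_compose continuous_on_Pair) (auto elim!: continuous_on_subset)
  then show ?thesis by (simp add: o_def)
qed

lemma semiflow_basin:
  assumes "semiflow S" "x \<in> basin S A" "0 \<le> t"
  shows "S t x \<in> basin S A"
proof -
  have "((\<lambda>s. infdist (S (s + t) x) A) \<longlongrightarrow> 0) at_top"
    by (rule filterlim_compose[of "\<lambda>s. infdist (S s x) A" _ at_top])
      (use assms(2,3) in \<open>auto simp: basin_def intro: filterlim_at_top_mono[OF filterlim_ident]\<close>)
  \<comment> \<open>The semigroup law is available only for nonnegative times, so the two
    expressions are compared for \<open>s\<close> at least 0.\<close>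
  moreover have "eventually (\<lambda>s. infdist (S (s + t) x) A = infdist (S s (S t x)) A) at_top"
    by (intro eventually_mono[OF eventually_ge_at_top[of 0]])
      (use assms(1,3) in \<open>simp add: semiflow_def\<close>)
  ultimately show ?thesis
    using assms(2) by (auto simp: basin_def intro: Lim_transform_eventually)
qed

text \<open>The distance to \<open>A\<close> vanishes identically along an orbit that starts in
  \<open>A\<close>. This puts limit points lying in the attractor into the basin, where
  \<open>V\<close> is controlled.\<close>

lemma invariant_subset_basin:
  assumes "invariant S A"
  shows "A \<subseteq> basin S A"
proof
  fix x assume "x \<in> A"
  then have "S t x \<in> A" if "0 \<le> t" for t
    using assms that unfolding invariant_def by blast
  then have "eventually (\<lambda>t. infdist (S t x) A = 0) at_top"
    by (intro eventually_mono[OF eventually_ge_at_top[of 0]]) simp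
  then show "x \<in> basin S A"
    using \<open>x \<in> A\<close> by (auto simp: basin_def intro: tendsto_eventually)
qed

text \<open>Nearest points \<open>p n\<close> in \<open>A\<close> to the orbit at integer times
  subconverge by compactness. The orbit approaches \<open>A\<close>, so it follows them to the same
  limit.\<close>

lemma omega_limit_meets_compact:
  assumes "compact A" "x \<in> basin S A"
  shows "omega_limit S x \<inter> A \<noteq> {}"
proof -
  have ne: "A \<noteq> {}" and lim: "((\<lambda>t. infdist (S t x) A) \<longlongrightarrow> 0) at_top"
    using assms(2) by (auto simp: basin_def)
  have "\<exists>q\<in>A. infdist z A = dist z q" for z
  proof -
    have "continuous_on A (dist z)"
      using continuous_on_dist[OF continuous_on_const continuous_on_id] .
    then obtain q where "q \<in> A" "\<And>w. w \<in> A \<Longrightarrow> dist z q \<le> dist z w"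
      using continuous_attains_inf[OF assms(1) ne] by blast
    then show ?thesis
      by (intro bexI[of _ q] antisym infdist_le)
        (auto simp: infdist_notempty[OF ne] intro: cINF_greatest[OF ne])
  qed
  then have "\<exists>p. \<forall>n. p n \<in> A \<and> infdist (S (real n) x) A = dist (S (real n) x) (p n)"
    by (intro choice) blast
  then obtain p where p: "\<And>n. p n \<in> A"
    and dist_p: "\<And>n. infdist (S (real n) x) A = dist (S (real n) x) (p n)" by blast
  obtain y r where y: "y \<in> A" and r: "strict_mono r" and py: "(p \<circ> r) \<longlonglongrightarrow> y"
    using assms(1) p unfolding compact_def by metis
  have r_top: "filterlim (\<lambda>n. real (r n)) at_top sequentially"
    using filterlim_compose[OF filterlim_real_sequentially filterlim_subseq[OF r]] .
  have "(\<lambda>n. dist (S (real (r n)) x) (p (r n))) \<longlonglongrightarrow> 0"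
    using filterlim_compose[OF lim r_top] by (simp add: dist_p)
  moreover have "(\<lambda>n. dist (p (r n)) y) \<longlonglongrightarrow> 0"
    using py by (simp add: tendsto_dist_iff[of _ y] o_def)
  ultimately have "(\<lambda>n. dist (S (real (r n)) x) (p (r n)) + dist (p (r n)) y) \<longlonglongrightarrow> 0"
    by (rule tendsto_add_zero)
  from tendsto_sandwich[OF _ _ tendsto_const this]
  have "(\<lambda>n. dist (S (real (r n)) x) y) \<longlonglongrightarrow> 0"
    by (simp add: dist_triangle)
  then have "(\<lambda>n. S (real (r n)) x) \<longlonglongrightarrow> y"
    by (simp add: tendsto_dist_iff[of _ y])
  then have "y \<in> omega_limit S x"
    using r_top by (auto simp: omega_limit_def intro!: exI[of _ "\<lambda>n. real (r n)"])
  then show ?thesis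
    using y by blast
qed

section \<open>Lyapunov functions along orbits\<close>

lemma morse_lyapunov_strict_antimono:
  assumes "morse_lyapunov S l M \<Omega> V" "x \<in> \<Omega>" "V x \<notin> generalized_critical_values l M V"
  shows "strict_antimono_on {0..} (\<lambda>t. V (S t x))"
proof -
  have "constant_value V (M k) = V x" if "k \<in> {1..l}" "x \<in> M k" for k
  proof -
    have "V constant_on M k"
      using assms(1) that(1) by (simp add: morse_lyapunov_def)
    \<comment> \<open>The point \<open>x\<close> makes \<open>M k\<close> nonempty, so the definite
      description in \<open>constant_value\<close> has a unique solution.\<close>
    then have "V ` M k = {V x}"
      using that(2) by (auto simp: constant_on_def)
    then show ?thesis by (simp add: constant_value_def)
  qed
  then have "x \<notin> (\<Union>k\<in>{1..l}. M k)"
    using assms(3) unfolding generalized_critical_values_def by (metis UN_E imageI)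
  then show ?thesis
    using assms(1,2) by (simp add: morse_lyapunov_def)
qed

text \<open>Along times \<open>t n\<close> with \<open>S (t n) x\<close> tending to
  \<open>y\<close>, the values \<open>V (S (s + t n) x)\<close> tend to \<open>V (S s y)\<close> by
  continuity and to \<open>c\<close> by hypothesis.\<close>

lemma lyapunov_constant_on_omega_limit:
  fixes V :: "'a::metric_space \<Rightarrow> 'b::t2_space"
  assumes S: "semiflow S" and V: "continuous_on \<Omega> V"
    and \<Omega>: "\<And>t x. 0 \<le> t \<Longrightarrow> x \<in> \<Omega> \<Longrightarrow> S t x \<in> \<Omega>"
    and x: "x \<in> \<Omega>" and y: "y \<in> omega_limit S x" "y \<in> \<Omega>"
    and lim: "((\<lambda>t. V (S t x)) \<longlongrightarrow> c) at_top" and "0 \<le> s"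
  shows "V (S s y) = c"
proof -
  obtain t :: "nat \<Rightarrow> real" where t: "\<And>n. 0 \<le> t n" "filterlim t at_top sequentially"
    and ty: "(\<lambda>n. S (t n) x) \<longlonglongrightarrow> y"
    using y(1) by (auto simp: omega_limit_def)
  have "continuous_on \<Omega> (\<lambda>z. V (S s z))"
    using \<Omega> \<open>0 \<le> s\<close> by (intro continuous_on_compose2[OF V] semiflow_continuous_on[OF S])
      (auto intro: continuous_on_id)
  then have "(\<lambda>n. V (S s (S (t n) x))) \<longlonglongrightarrow> V (S s y)"
    using continuous_on_tendsto_compose ty y(2) \<Omega> t(1) x by fastforce
  moreover have "S s (S (t n) x) = S (s + t n) x" for n
    using S t(1) \<open>0 \<le> s\<close> by (simp add: semiflow_def)
  moreover have "(\<lambda>n. V (S (s + t n) x)) \<longlonglongrightarrow> c"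
    by (rule filterlim_compose[OF lim filterlim_tendsto_add_at_top[OF tendsto_const t(2)]])
  ultimately show ?thesis
    using LIMSEQ_unique by auto
qed

text \<open>The limit is the infimum of the values. The bounds on \<open>c\<close> later keep it
  inside the range free of critical values.\<close>

lemma antimono_bounded_below_convergent_at_top:
  fixes f :: "real \<Rightarrow> real"
  assumes "antimono_on {0..} f" "\<And>t. 0 \<le> t \<Longrightarrow> a \<le> f t"
  shows "\<exists>c\<ge>a. c \<le> f 0 \<and> (f \<longlongrightarrow> c) at_top"
proof (intro exI conjI)
  let ?c = "Inf (f ` {0..})"
  have bdd: "bdd_below (f ` {0..})"
    using assms(2) by (auto intro!: bdd_belowI)
  show "a \<le> ?c"
    using assms(2) by (auto intro!: cInf_greatest)
  show "?c \<le> f 0"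
    using bdd by (auto intro!: cInf_lower)
  show "(f \<longlongrightarrow> ?c) at_top"
  proof (rule order_tendstoI)
    fix u assume "u < ?c"
    moreover have "?c \<le> f t" if "0 \<le> t" for t
      using bdd that by (auto intro!: cInf_lower)
    ultimately show "eventually (\<lambda>t. u < f t) at_top"
      using eventually_ge_at_top[of 0] by (fastforce elim!: eventually_mono)
  next
    fix u assume "?c < u"
    then obtain s where s: "0 \<le> s" "f s < u"
      using cInf_lessD[of "f ` {0..}" u] by auto
    show "eventually (\<lambda>t. f t < u) at_top"
      using eventually_ge_at_top[of s]
    proof eventually_elim
      case (elim t)
      then have "f t \<le> f s"
        using assms(1) s(1) by (auto simp: monotone_on_def)
      then show ?case using s(2) by simp
    qed
  qed
qed

section \<open>Crossing times of a level\<close>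

lemma crossing_time_exists:
  fixes V :: "'a::metric_space \<Rightarrow> real"
  assumes S: "semiflow S" and A: "compact A" "invariant S A"
    and V: "continuous_on (basin S A) V"
    and dec: "\<And>y. y \<in> basin S A \<Longrightarrow> a \<le> V y \<Longrightarrow> V y \<le> b \<Longrightarrow>
                strict_antimono_on {0..} (\<lambda>t. V (S t y))"
    and x: "x \<in> basin S A" "a \<le> V x" "V x \<le> b"
  shows "\<exists>t\<ge>0. V (S t x) = a"
proof -
  have S0: "S 0 x = x" for x using S by (simp add: semiflow_def)
  have "\<exists>t\<ge>0. V (S t x) \<le> a"
  proof (rule ccontr)
    assume "\<not> ?thesis"
    then have above: "a \<le> V (S t x)" if "0 \<le> t" for t
      using that by (meson linear)
    moreover have "antimono_on {0..} (\<lambda>t. V (S t x))"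
      using dec[OF x] by (auto simp: monotone_on_def order.order_iff_strict)
    ultimately obtain c where c: "a \<le> c" "c \<le> V x" and lim: "((\<lambda>t. V (S t x)) \<longlongrightarrow> c) at_top"
      using antimono_bounded_below_convergent_at_top[of "\<lambda>t. V (S t x)" a] S0 by auto
    obtain y where y: "y \<in> omega_limit S x" "y \<in> A"
      using omega_limit_meets_compact[OF A(1) x(1)] by blast
    then have y\<Omega>: "y \<in> basin S A"
      using invariant_subset_basin[OF A(2)] by blast
    have const: "V (S s y) = c" if "0 \<le> s" for s
      using lyapunov_constant_on_omega_limit[OF S V semiflow_basin[OF S] x(1) y(1) y\<Omega> lim that]
      by blast
    \<comment> \<open>Since \<open>c\<close> lies between \<open>a\<close> and \<open>V x\<close>,
      hence in \<open>[a, b]\<close>, the hypothesis \<open>dec\<close> applies at \<open>y\<close>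
      and contradicts constancy already between times 0 and 1.\<close>
    then have "V y = c" using S0[of y] by (metis order_refl)
    then have "strict_antimono_on {0..} (\<lambda>t. V (S t y))"
      using dec[OF y\<Omega>] c x(3) by simp
    then have "V (S 1 y) < V (S 0 y)"
      by (rule monotone_onD) auto
    then show False using const by simp
  qed
  then obtain T where T: "0 \<le> T" "V (S T x) \<le> a" by blast
  have "continuous_on {0..T} (\<lambda>t. V (S t x))"
    using semiflow_basin[OF S x(1)]
    by (intro continuous_on_compose2[OF V] semiflow_continuous_on[OF S])
      (auto intro: continuous_on_id)
  then show ?thesis
    using IVT2'[of "\<lambda>t. V (S t x)" T a 0] T x(2) S0 by auto
qed

text \<open>By strict monotonicity, for nonnegative \<open>u\<close>, \<open>u < \<tau> x\<close>
  means \<open>a < \<phi> u x\<close>, and \<open>\<tau> x < u\<close> means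
  \<open>\<phi> u x < a\<close>. Both conditions are open in \<open>x\<close> because
  \<open>\<phi> u\<close> is continuous.\<close>

lemma crossing_time_continuous:
  fixes \<phi> :: "real \<Rightarrow> 'a::topological_space \<Rightarrow> real" and \<tau> :: "'a \<Rightarrow> real"
  assumes cont: "\<And>t. 0 \<le> t \<Longrightarrow> continuous_on E (\<phi> t)"
    and dec: "\<And>x. x \<in> E \<Longrightarrow> strict_antimono_on {0..} (\<lambda>t. \<phi> t x)"
    and \<tau>: "\<And>x. x \<in> E \<Longrightarrow> 0 \<le> \<tau> x" "\<And>x. x \<in> E \<Longrightarrow> \<phi> (\<tau> x) x = a"
  shows "continuous_on E \<tau>"
proof -
  have less_iff: "\<phi> s x < \<phi> t x \<longleftrightarrow> t < s" if "x \<in> E" "0 \<le> t" "0 \<le> s" for x s t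
    using monotone_onD[OF dec[OF that(1)], of t s] monotone_onD[OF dec[OF that(1)], of s t] that
    by (cases t s rule: linorder_cases) auto
  have near: "eventually (\<lambda>x. x \<in> E) (at x0 within E)" for x0
    by (simp add: eventually_at_filter)
  show ?thesis
    unfolding continuous_on_def
  proof (intro ballI order_tendstoI)
    fix x0 u assume x0: "x0 \<in> E" and u: "u < \<tau> x0"
    show "eventually (\<lambda>x. u < \<tau> x) (at x0 within E)"
    \<comment> \<open>Nothing is known about \<open>\<phi> u\<close> for negative \<open>u\<close>;
      there the bound follows from \<open>\<tau>\<close> being nonnegative.\<close>
    proof (cases "0 \<le> u")
      case True
      then have "a < \<phi> u x0"
        using less_iff[OF x0 True \<tau>(1)[OF x0]] \<tau>(2)[OF x0] u by simp
      then have "eventually (\<lambda>x. a < \<phi> u x) (at x0 within E)"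
        using cont[OF True] x0 by (auto simp: continuous_on_def intro: order_tendstoD)
      with near[of x0] show ?thesis
        by eventually_elim (metis less_iff True \<tau>)
    next
      case False
      with near[of x0] show ?thesis
        by (auto elim!: eventually_mono dest: \<tau>(1))
    qed
  next
    fix x0 u assume x0: "x0 \<in> E" and u: "\<tau> x0 < u"
    then have u0: "0 \<le> u" using \<tau>(1)[OF x0] by simp
    then have "\<phi> u x0 < a"
      using less_iff[OF x0 \<tau>(1)[OF x0] u0] \<tau>(2)[OF x0] u by simp
    then have "eventually (\<lambda>x. \<phi> u x < a) (at x0 within E)"
      using cont[OF u0] x0 by (auto simp: continuous_on_def intro: order_tendstoD)
    with near[of x0] show "eventually (\<lambda>x. \<tau> x < u) (at x0 within E)"
      by eventually_elim (metis less_iff u0 \<tau>)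
  qed
qed

section \<open>The deformation of sublevel sets\<close>

theorem theorem5p1:
  fixes S :: "real \<Rightarrow> 'a::complete_space \<Rightarrow> 'a"
    and \<A> :: "'a set"
    and l :: nat
    and M :: "nat \<Rightarrow> 'a set"
    and V :: "'a \<Rightarrow> real"
    and a b :: real
  assumes "semiflow S"
    and "asymptotically_compact S"
    and "attractor S \<A>"
    and "morse_decomposition S \<A> l M"
    and "strict_morse_lyapunov S l M (basin S \<A>) V"
    and "a < b"
    and "generalized_critical_values l M V \<inter> {a..b} = {}"
  shows "strong_deformation_retract
           (sublevel (basin S \<A>) V a) (sublevel (basin S \<A>) V b)"
proof -
  let ?\<Omega> = "basin S \<A>"
  let ?E = "sublevel ?\<Omega> V b"
  \<comment> \<open>The slab includes the level \<open>a\<close> itself, so that it overlaps the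
    sublevel set of \<open>a\<close> exactly where the two formulas for \<open>\<tau>\<close> are
    glued.\<close>
  define slab where "slab = {x \<in> ?E. a \<le> V x}"
  note S = assms(1)
  have S0: "S 0 x = x" for x using S by (simp add: semiflow_def)
  have A: "compact \<A>" "invariant S \<A>"
    using assms(3) by (auto simp: attractor_in_def)
  have lyap: "morse_lyapunov S l M ?\<Omega> V" and V: "continuous_on ?\<Omega> V"
    using assms(5) by (auto simp: strict_morse_lyapunov_def morse_lyapunov_def)
  have V_E: "continuous_on ?E V"
    using V by (rule continuous_on_subset) (auto simp: sublevel_def)
  have dec: "strict_antimono_on {0..} (\<lambda>t. V (S t x))" if "x \<in> ?\<Omega>" "a \<le> V x" "V x \<le> b" for x
    using morse_lyapunov_strict_antimono[OF lyap that(1)] assms(7) that(2,3) by fastforce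
  have "\<forall>x\<in>slab. \<exists>t\<ge>0. V (S t x) = a"
    using crossing_time_exists[OF S A V dec] by (auto simp: slab_def sublevel_def)
  then obtain \<theta> where \<theta>: "\<And>x. x \<in> slab \<Longrightarrow> 0 \<le> \<theta> x" "\<And>x. x \<in> slab \<Longrightarrow> V (S (\<theta> x) x) = a"
    by metis
  have cont_\<theta>: "continuous_on slab \<theta>"
  proof (rule crossing_time_continuous[where \<phi> = "\<lambda>t x. V (S t x)"])
    show "continuous_on slab (\<lambda>x. V (S t x))" if "0 \<le> t" for t
      using semiflow_basin[OF S] that
      by (intro continuous_on_compose2[OF V] semiflow_continuous_on[OF S])
        (auto intro: continuous_on_id simp: slab_def sublevel_def)
  qed (use dec \<theta> in \<open>auto simp: slab_def sublevel_def\<close>)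
  \<comment> \<open>Agreement on the common level: a positive crossing time would force
    \<open>V\<close> strictly below \<open>a\<close>.\<close>
  have \<theta>_level: "\<theta> x = 0" if "x \<in> slab" "V x = a" for x
  proof (rule ccontr)
    assume "\<theta> x \<noteq> 0"
    then have "V (S (\<theta> x) x) < V (S 0 x)"
      using monotone_onD[OF dec, of x 0 "\<theta> x"] \<theta>(1)[OF that(1)] that
      by (auto simp: slab_def sublevel_def)
    then show False using \<theta>(2)[OF that(1)] that(2) S0 by simp
  qed
  define \<tau> where "\<tau> x = (if V x \<le> a then 0 else \<theta> x)" for x
  have cont_\<tau>: "continuous_on ?E \<tau>"
    unfolding \<tau>_def using V_E cont_\<theta> \<theta>_level
    by (intro continuous_on_cases_le) (auto simp: slab_def)
  have \<tau>_nonneg: "0 \<le> \<tau> x" if "x \<in> ?E" for x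
    using \<theta>(1) that by (auto simp: \<tau>_def slab_def)
  \<comment> \<open>Time is rescaled linearly, so \<open>\<sigma> = 1\<close> reaches the crossing.
    Points with \<open>V x \<le> a\<close> have \<open>\<tau> x = 0\<close> and stay fixed.\<close>
  define H where "H = (\<lambda>(\<sigma>, x). S (\<sigma> * \<tau> x) x)"
  show ?thesis
    unfolding strong_deformation_retract_def
  proof (intro conjI exI[of _ H] ballI)
    show "sublevel ?\<Omega> V a \<subseteq> ?E"
      using assms(6) by (auto simp: sublevel_def)
    have "continuous_on ({0..1} \<times> ?E) (\<lambda>p. \<tau> (snd p))"
      by (rule continuous_on_compose2[OF cont_\<tau> continuous_on_snd]) (auto intro: continuous_on_id)
    then show "continuous_on ({0..1} \<times> ?E) H"
      unfolding H_def case_prod_beta using \<tau>_nonneg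
      by (intro semiflow_continuous_on[OF S] continuous_intros) auto
    show "H ` ({0..1} \<times> ?E) \<subseteq> ?E"
    proof clarify
      fix \<sigma> :: real and x assume \<sigma>: "\<sigma> \<in> {0..1}" and x: "x \<in> ?E"
      let ?t = "\<sigma> * \<tau> x"
      have t: "0 \<le> ?t" using \<sigma> \<tau>_nonneg[OF x] by simp
      have "V (S ?t x) \<le> V x"
      \<comment> \<open>In the first case the point has not moved; otherwise it starts in the slab
        and flows for a positive time, so \<open>dec\<close> gives a strict decrease.\<close>
      proof (cases "V x \<le> a \<or> ?t = 0")
        case True
        then show ?thesis by (auto simp: \<tau>_def S0)
      next
        case False
        with t have "0 < ?t" by linarith
        then have "V (S ?t x) < V (S 0 x)"
          using monotone_onD[OF dec, of x 0 ?t] False x by (auto simp: sublevel_def)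
        then show ?thesis by (simp add: S0)
      qed
      then show "H (\<sigma>, x) \<in> ?E"
        using x semiflow_basin[OF S _ t, of x] by (auto simp: H_def sublevel_def)
    qed
    show "H (0, x) = x" for x by (simp add: H_def S0)
    show "H (1, x) \<in> sublevel ?\<Omega> V a" if "x \<in> ?E" for x
    proof (cases "V x \<le> a")
      case True
      then show ?thesis using that by (simp add: H_def \<tau>_def S0 sublevel_def)
    next
      case False
      then have "x \<in> slab" using that by (simp add: slab_def)
      then show ?thesis
        using False that \<theta> semiflow_basin[OF S] by (simp add: H_def \<tau>_def sublevel_def)
    qed
    show "H (\<sigma>, x) = x" if "x \<in> sublevel ?\<Omega> V a" for \<sigma> x
      using that by (simp add: H_def \<tau>_def S0 sublevel_def)
  qed
qed

end
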